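(* Let $R$ be a commutative Noetherian local ring and $M$ a finitely generated torsion-free $R$-module with (constant) rank such that $E=\operatorname{End}_R(M)$ is a local ring (e.g. $R$ Henselian and $M$ indecomposable) and $E$ possesses an $R^*$-algebra structure. Suppose either (1) $R$ is a domain, or (2) $R$ is reduced of characteristic $2$. If the $R$-module $M_*\otimes_E M$ is torsion-free, then $M$ is a cyclic $E$-module.
   Context: An $R$-algebra $E$ (possibly noncommutative) is an $R^*$-algebra if there is a map of abelian groups $(-)^*:E\to E$ with $(ab)^*=b^*a^*$, $1_E^*=1_E$, $(ra)^*=ra^*$ for $r\in R$, and $a^{**}=a$ for all $a,b\in E$. $M$ is a left $E$-module via $f\cdot x=f(x)$, and $M_*$ denotes $M$ regarded as a right $E$-module via $x\cdot f=f^*(x)$. $M$ has rank $r$ if $M\otimes_R Q$ is free of rank $r$ over the total quotient ring $Q$ of $R$. An $R$-module is torsion-free if no nonzero element is annihilated by a nonzerodivisor of $R$. *)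

theory Defs
  imports Main HOL.Modules "HOL-Library.FuncSet"
begin

definition nzd :: "'r::comm_ring_1 \<Rightarrow> bool" where
  "nzd s \<longleftrightarrow> (\<forall>y. s * y = 0 \<longrightarrow> y = 0)"

definition is_ideal :: "'r::comm_ring_1 set \<Rightarrow> bool" where
  "is_ideal I \<longleftrightarrow> 0 \<in> I \<and> (\<forall>x\<in>I. \<forall>y\<in>I. x + y \<in> I) \<and> (\<forall>r. \<forall>x\<in>I. r * x \<in> I)"

definition noetherian_ring :: "'r::comm_ring_1 itself \<Rightarrow> bool" where
  "noetherian_ring _ \<longleftrightarrow>
     (\<forall>C :: nat \<Rightarrow> 'r set. (\<forall>n. is_ideal (C n) \<and> C n \<subseteq> C (Suc n)) \<longrightarrow> (\<exists>N. \<forall>n\<ge>N. C n = C N))"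

definition maximal_ideal :: "'r::comm_ring_1 set \<Rightarrow> bool" where
  "maximal_ideal I \<longleftrightarrow> is_ideal I \<and> 1 \<notin> I \<and>
     (\<forall>J. is_ideal J \<and> I \<subseteq> J \<and> 1 \<notin> J \<longrightarrow> J = I)"

definition local_ring :: "'r::comm_ring_1 itself \<Rightarrow> bool" where
  "local_ring _ \<longleftrightarrow> (\<exists>!I :: 'r set. maximal_ideal I)"

definition is_domain :: "'r::comm_ring_1 itself \<Rightarrow> bool" where
  "is_domain _ \<longleftrightarrow> (1::'r) \<noteq> 0 \<and> (\<forall>a b :: 'r. a * b = 0 \<longrightarrow> a = 0 \<or> b = 0)"

definition is_reduced :: "'r::comm_ring_1 itself \<Rightarrow> bool" where
  "is_reduced _ \<longleftrightarrow> (\<forall>(x::'r) (n::nat). x ^ n = 0 \<longrightarrow> x = 0)"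

definition char_two :: "'r::comm_ring_1 itself \<Rightarrow> bool" where
  "char_two _ \<longleftrightarrow> (2::'r) = 0 \<and> (1::'r) \<noteq> 0"

definition fin_gen :: "('r::comm_ring_1 \<Rightarrow> 'm::ab_group_add \<Rightarrow> 'm) \<Rightarrow> bool" where
  "fin_gen sc \<longleftrightarrow> (\<exists>S. finite S \<and> (\<forall>x. \<exists>c. x = (\<Sum>a\<in>S. sc (c a) a)))"

definition torsion_free :: "('r::comm_ring_1 \<Rightarrow> 'm::ab_group_add \<Rightarrow> 'm) \<Rightarrow> bool" where
  "torsion_free sc \<longleftrightarrow> (\<forall>r x. nzd r \<and> sc r x = 0 \<longrightarrow> x = 0)"

subsection \<open>Total quotient ring Q = S^-1 R and M (x) Q = S^-1 M, S = nonzerodivisors\<close>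

definition rclass :: "'r::comm_ring_1 \<times> 'r \<Rightarrow> ('r \<times> 'r) set" where
  "rclass p = {(b, t). nzd t \<and> (\<exists>u. nzd u \<and> u * (t * fst p - snd p * b) = 0)}"

definition Qring :: "('r::comm_ring_1 \<times> 'r) set set" where
  "Qring = {rclass (a, s) | a s. nzd s}"

definition mclass :: "('r::comm_ring_1 \<Rightarrow> 'm::ab_group_add \<Rightarrow> 'm) \<Rightarrow> 'm \<times> 'r \<Rightarrow> ('m \<times> 'r) set" where
  "mclass sc p = {(m', t). nzd t \<and> (\<exists>u. nzd u \<and> sc u (sc t (fst p) - sc (snd p) m') = 0)}"

definition locM :: "('r::comm_ring_1 \<Rightarrow> 'm::ab_group_add \<Rightarrow> 'm) \<Rightarrow> ('m \<times> 'r) set set" where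
  "locM sc = {mclass sc (m, s) | m s. nzd s}"

definition lplus :: "('r::comm_ring_1 \<Rightarrow> 'm::ab_group_add \<Rightarrow> 'm) \<Rightarrow> ('m \<times> 'r) set \<Rightarrow> ('m \<times> 'r) set \<Rightarrow> ('m \<times> 'r) set" where
  "lplus sc X Y = \<Union>{mclass sc (sc s' m + sc s m', s * s') | m s m' s'. (m, s) \<in> X \<and> (m', s') \<in> Y}"

definition lsmul :: "('r::comm_ring_1 \<Rightarrow> 'm::ab_group_add \<Rightarrow> 'm) \<Rightarrow> ('r \<times> 'r) set \<Rightarrow> ('m \<times> 'r) set \<Rightarrow> ('m \<times> 'r) set" where
  "lsmul sc q X = \<Union>{mclass sc (sc a m, t * s) | a t m s. (a, t) \<in> q \<and> (m, s) \<in> X}"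

primrec lsum :: "('r::comm_ring_1 \<Rightarrow> 'm::ab_group_add \<Rightarrow> 'm) \<Rightarrow> (nat \<Rightarrow> ('r \<times> 'r) set) \<Rightarrow> (nat \<Rightarrow> ('m \<times> 'r) set) \<Rightarrow> nat \<Rightarrow> ('m \<times> 'r) set" where
  "lsum sc q b 0 = mclass sc (0, 1)"
| "lsum sc q b (Suc k) = lplus sc (lsum sc q b k) (lsmul sc (q k) (b k))"

text \<open>M has rank n: M (x)_R Q (realised as S^-1 M) is a free Q-module of rank n.\<close>
definition has_rank :: "('r::comm_ring_1 \<Rightarrow> 'm::ab_group_add \<Rightarrow> 'm) \<Rightarrow> nat \<Rightarrow> bool" where
  "has_rank sc n \<longleftrightarrow> (\<exists>b. (\<forall>i<n. b i \<in> locM sc) \<and>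
     (\<forall>y\<in>locM sc. \<exists>!q. q \<in> {..<n} \<rightarrow>\<^sub>E Qring \<and> y = lsum sc q b n))"

definition Endo :: "('r::comm_ring_1 \<Rightarrow> 'm::ab_group_add \<Rightarrow> 'm) \<Rightarrow> ('m \<Rightarrow> 'm) set" where
  "Endo sc = {f. module_hom sc sc f}"

definition left_ideal_E :: "('r::comm_ring_1 \<Rightarrow> 'm::ab_group_add \<Rightarrow> 'm) \<Rightarrow> ('m \<Rightarrow> 'm) set \<Rightarrow> bool" where
  "left_ideal_E sc I \<longleftrightarrow> I \<subseteq> Endo sc \<and> (\<lambda>x. 0) \<in> I \<and>
     (\<forall>f\<in>I. \<forall>g\<in>I. (\<lambda>x. f x + g x) \<in> I) \<and> (\<forall>f\<in>Endo sc. \<forall>g\<in>I. f \<circ> g \<in> I)"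

definition max_left_ideal_E :: "('r::comm_ring_1 \<Rightarrow> 'm::ab_group_add \<Rightarrow> 'm) \<Rightarrow> ('m \<Rightarrow> 'm) set \<Rightarrow> bool" where
  "max_left_ideal_E sc I \<longleftrightarrow> left_ideal_E sc I \<and> id \<notin> I \<and>
     (\<forall>J. left_ideal_E sc J \<and> I \<subseteq> J \<and> id \<notin> J \<longrightarrow> J = I)"

definition End_local :: "('r::comm_ring_1 \<Rightarrow> 'm::ab_group_add \<Rightarrow> 'm) \<Rightarrow> bool" where
  "End_local sc \<longleftrightarrow> (\<exists>!I. max_left_ideal_E sc I)"

definition star_structure :: "('r::comm_ring_1 \<Rightarrow> 'm::ab_group_add \<Rightarrow> 'm) \<Rightarrow> (('m \<Rightarrow> 'm) \<Rightarrow> ('m \<Rightarrow> 'm)) \<Rightarrow> bool" where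
  "star_structure sc st \<longleftrightarrow>
     (\<forall>f\<in>Endo sc. st f \<in> Endo sc) \<and>
     (\<forall>f\<in>Endo sc. \<forall>g\<in>Endo sc. st (\<lambda>x. f x + g x) = (\<lambda>x. st f x + st g x)) \<and>
     (\<forall>f\<in>Endo sc. \<forall>g\<in>Endo sc. st (f \<circ> g) = st g \<circ> st f) \<and>
     st id = id \<and>
     (\<forall>r. \<forall>f\<in>Endo sc. st (\<lambda>x. sc r (f x)) = (\<lambda>x. sc r (st f x))) \<and>
     (\<forall>f\<in>Endo sc. st (st f) = f)"

subsection \<open>The R-module M_* (x)_E M as (free R-module on M x M) / relations\<close>

definition delta :: "'a \<Rightarrow> 'a \<Rightarrow> 'r::comm_ring_1" where
  "delta p = (\<lambda>q. if q = p then 1 else 0)"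

inductive_set tens_rel :: "('r::comm_ring_1 \<Rightarrow> 'm::ab_group_add \<Rightarrow> 'm) \<Rightarrow> (('m \<Rightarrow> 'm) \<Rightarrow> ('m \<Rightarrow> 'm)) \<Rightarrow> ('m \<times> 'm \<Rightarrow> 'r) set"
  for sc st where
  zero: "(\<lambda>_. 0) \<in> tens_rel sc st"
| add: "a \<in> tens_rel sc st \<Longrightarrow> b \<in> tens_rel sc st \<Longrightarrow> (\<lambda>q. a q + b q) \<in> tens_rel sc st"
| smult: "a \<in> tens_rel sc st \<Longrightarrow> (\<lambda>q. r * a q) \<in> tens_rel sc st"
| addl: "(\<lambda>q. delta (x + x', y) q - delta (x, y) q - delta (x', y) q) \<in> tens_rel sc st"
| addr: "(\<lambda>q. delta (x, y + y') q - delta (x, y) q - delta (x, y') q) \<in> tens_rel sc st"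
| scl: "(\<lambda>q. delta (sc r x, y) q - r * delta (x, y) q) \<in> tens_rel sc st"
| scr: "(\<lambda>q. delta (x, sc r y) q - r * delta (x, y) q) \<in> tens_rel sc st"
| bal: "f \<in> Endo sc \<Longrightarrow> (\<lambda>q. delta (st f x, y) q - delta (x, f y) q) \<in> tens_rel sc st"

text \<open>Torsion-freeness of the quotient module (finitely supported functions) / tens_rel.\<close>
definition tensor_torsion_free :: "('r::comm_ring_1 \<Rightarrow> 'm::ab_group_add \<Rightarrow> 'm) \<Rightarrow> (('m \<Rightarrow> 'm) \<Rightarrow> ('m \<Rightarrow> 'm)) \<Rightarrow> bool" where
  "tensor_torsion_free sc st \<longleftrightarrow>
     (\<forall>r t. nzd r \<and> finite {q. t q \<noteq> 0} \<and> (\<lambda>q. r * t q) \<in> tens_rel sc st \<longrightarrow> t \<in> tens_rel sc st)"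

definition cyclic_E_module :: "('r::comm_ring_1 \<Rightarrow> 'm::ab_group_add \<Rightarrow> 'm) \<Rightarrow> bool" where
  "cyclic_E_module sc \<longleftrightarrow> (\<exists>x. \<forall>y. \<exists>f\<in>Endo sc. y = f x)"

end

theory Submission
  imports Defs
begin

text \<open>Since \<open>M\<close> has a rank, \<open>E\<close> becomes a matrix algebra and \<open>M\<^sub>* \<otimes>\<^sub>E M\<close> a rank one module
  after inverting the nonzerodivisors of \<open>R\<close>, so the involution \<open>x \<otimes> y \<mapsto> y \<otimes> x\<close> of this tensor
  product is multiplication by some \<open>u\<close> with \<open>u\<^sup>2 = 1\<close>. Over a domain \<open>u = 1\<close> or \<open>u = -1\<close>; in
  characteristic 2, \<open>(u - 1)\<^sup>2 = 0\<close> and reducedness give \<open>u = 1\<close>. As the tensor product is torsion-free,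
  \<open>x \<otimes> y = \<plusminus> y \<otimes> x\<close> holds before localising. For the radical \<open>J\<close> of the local ring \<open>E\<close>, this relation
  would identify \<open>a \<otimes> b\<close> with \<open>\<plusminus> b \<otimes> a\<close> for two members of a minimal generating set of \<open>M\<close>, although their
  images over the division ring \<open>E/J\<close> are linearly independent. So one generator suffices.\<close>

section \<open>Nonzerodivisors and fractions of ring elements\<close>

lemma nzd_mult: "nzd a \<Longrightarrow> nzd b \<Longrightarrow> nzd (a * b)"
  unfolding nzd_def by (metis mult.assoc)

lemma nzd_one: "nzd 1"
  by (simp add: nzd_def)

lemma nzd_prod: "finite A \<Longrightarrow> (\<And>a. a \<in> A \<Longrightarrow> nzd (f a)) \<Longrightarrow> nzd (prod f A)"
  by (induction A rule: finite_induct) (auto simp: nzd_one nzd_mult)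

lemma nzd_mult_cancel: "nzd s \<Longrightarrow> s * a = s * b \<Longrightarrow> a = b"
  unfolding nzd_def by (metis right_diff_distrib right_minus_eq)

text \<open>The factor \<open>u\<close> in \<open>rclass\<close> is a nonzerodivisor and can be
  cancelled, so equality of fractions is plain cross-multiplication.\<close>

lemma rclass_eq: "rclass (a, s) = {(b, t). nzd t \<and> t * a = s * b}"
proof -
  have "(\<exists>u. nzd u \<and> u * (t * a - s * b) = 0) \<longleftrightarrow> t * a = s * b" for t b
    using nzd_one unfolding nzd_def
    by (metis right_minus_eq mult_zero_right)
  then show ?thesis by (auto simp: rclass_def)
qed

lemma Ex1_unique: "\<exists>!x. P x \<Longrightarrow> P a \<Longrightarrow> P b \<Longrightarrow> a = b"
  by blast

context module
begin

section \<open>Torsion-free cancellation and closure properties of endomorphisms\<close>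

lemma nzd_scale_cancel:
  assumes "torsion_free scale" "nzd s" "s *s x = s *s y"
  shows "x = y"
  using assms unfolding torsion_free_def by (metis scale_right_diff_distrib right_minus_eq)

lemma Endo_iff: "f \<in> Endo scale \<longleftrightarrow> (\<forall>x y. f (x + y) = f x + f y) \<and> (\<forall>r x. f (r *s x) = r *s f x)"
  by (auto simp: Endo_def module_hom_iff module_axioms)

lemma Endo_add: "f \<in> Endo scale \<Longrightarrow> f (x + y) = f x + f y"
  and Endo_scale: "f \<in> Endo scale \<Longrightarrow> f (r *s x) = r *s f x"
  by (auto simp: Endo_iff)

lemma Endo_zero: "f \<in> Endo scale \<Longrightarrow> f 0 = 0"
  and Endo_neg: "f \<in> Endo scale \<Longrightarrow> f (- x) = - f x"
  and Endo_diff: "f \<in> Endo scale \<Longrightarrow> f (x - y) = f x - f y"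
  and Endo_sum: "f \<in> Endo scale \<Longrightarrow> f (sum u A) = (\<Sum>a\<in>A. f (u a))"
  by (simp_all add: Endo_def module_hom.zero module_hom.neg module_hom.diff module_hom.sum)

lemma id_Endo: "id \<in> Endo scale"
  and zero_Endo: "(\<lambda>x. 0) \<in> Endo scale"
  and comp_Endo: "f \<in> Endo scale \<Longrightarrow> g \<in> Endo scale \<Longrightarrow> f \<circ> g \<in> Endo scale"
  and add_Endo: "f \<in> Endo scale \<Longrightarrow> g \<in> Endo scale \<Longrightarrow> (\<lambda>x. f x + g x) \<in> Endo scale"
  and diff_Endo: "f \<in> Endo scale \<Longrightarrow> g \<in> Endo scale \<Longrightarrow> (\<lambda>x. f x - g x) \<in> Endo scale"
  and scale_Endo: "f \<in> Endo scale \<Longrightarrow> (\<lambda>x. r *s f x) \<in> Endo scale"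
  by (auto simp: Endo_iff scale_right_distrib scale_right_diff_distrib mult.commute)

subsection \<open>A linear form from the rank hypothesis\<close>

lemma mclass_eq:
  assumes "torsion_free scale"
  shows "mclass scale (m, s) = {(m', t). nzd t \<and> t *s m = s *s m'}"
proof -
  have "(\<exists>u. nzd u \<and> u *s (t *s m - s *s m') = 0) \<longleftrightarrow> t *s m = s *s m'" for t m'
    using assms nzd_one unfolding torsion_free_def
    by (metis right_minus_eq scale_zero_right)
  then show ?thesis by (auto simp: mclass_def)
qed

text \<open>Cross-multiplication is transitive: multiplying by \<open>s\<close> or \<open>s'\<close>
  turns one membership condition into the other, and torsion-freeness cancels the factor
  again.\<close>

lemma mclass_cong:
  assumes tf: "torsion_free scale" and "nzd s" "nzd s'" and eq: "s' *s m = s *s m'"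
  shows "mclass scale (m, s) = mclass scale (m', s')"
proof -
  have "t *s m = s *s n \<longleftrightarrow> t *s m' = s' *s n" for t n
  proof
    assume "t *s m = s *s n"
    then have "s *s (t *s m') = s *s (s' *s n)"
      using eq by (metis scale_left_commute)
    then show "t *s m' = s' *s n" using nzd_scale_cancel[OF tf] assms by blast
  next
    assume "t *s m' = s' *s n"
    then have "s' *s (t *s m) = s' *s (s *s n)"
      using eq by (metis scale_left_commute)
    then show "t *s m = s *s n" using nzd_scale_cancel[OF tf] assms by blast
  qed
  then show ?thesis by (simp add: mclass_eq[OF tf])
qed

lemma mclass_self: "nzd s \<Longrightarrow> torsion_free scale \<Longrightarrow> (m, s) \<in> mclass scale (m, s)"
  by (simp add: mclass_eq)

lemma rclass_self: "nzd s \<Longrightarrow> (a, s) \<in> rclass (a, s)"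
  by (simp add: rclass_eq)

text \<open>\<open>lplus\<close> is a union over all pairs of representatives. Every pair gives the
  same class and at least one pair exists, so the union is that class.\<close>

lemma lplus_mclass:
  assumes tf: "torsion_free scale" and s: "nzd s" "nzd s'"
  shows "lplus scale (mclass scale (m, s)) (mclass scale (m', s')) = mclass scale (s' *s m + s *s m', s * s')"
proof -
  have "mclass scale (u' *s n + u *s n', u * u') = mclass scale (s' *s m + s *s m', s * s')"
    if "(n, u) \<in> mclass scale (m, s)" "(n', u') \<in> mclass scale (m', s')" for n u n' u'
  proof -
    have u: "nzd u" "u *s m = s *s n" "nzd u'" "u' *s m' = s' *s n'"
      using that by (auto simp: mclass_eq[OF tf])
    have "(s * s') *s (u' *s n + u *s n') = (s' * u') *s (s *s n) + (s * u) *s (s' *s n')"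
      by (simp add: scale_right_distrib algebra_simps)
    also have "\<dots> = (u * u') *s (s' *s m + s *s m')"
      by (simp add: u(2,4)[symmetric] scale_right_distrib algebra_simps)
    finally show ?thesis
      using s u by (intro mclass_cong[OF tf]) (auto simp: nzd_mult)
  qed
  then have "{mclass scale (u' *s n + u *s n', u * u') | n u n' u'.
      (n, u) \<in> mclass scale (m, s) \<and> (n', u') \<in> mclass scale (m', s')} = {mclass scale (s' *s m + s *s m', s * s')}"
    using mclass_self[OF s(1) tf] mclass_self[OF s(2) tf] by blast
  then show ?thesis by (simp add: lplus_def)
qed

lemma lsmul_mclass:
  assumes tf: "torsion_free scale" and s: "nzd t" "nzd s"
  shows "lsmul scale (rclass (a, t)) (mclass scale (m, s)) = mclass scale (a *s m, t * s)"
proof -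
  have "mclass scale (a' *s n, t' * u) = mclass scale (a *s m, t * s)"
    if "(a', t') \<in> rclass (a, t)" "(n, u) \<in> mclass scale (m, s)" for a' t' n u
  proof -
    have u: "nzd u" "u *s m = s *s n" "nzd t'" "t' * a = t * a'"
      using that by (auto simp: mclass_eq[OF tf] rclass_eq)
    have "(t * s) *s (a' *s n) = (t * a') *s (s *s n)"
      by (simp add: algebra_simps)
    also have "\<dots> = (t' * u) *s (a *s m)"
      by (simp only: u(2,4)[symmetric]) (simp add: ac_simps)
    finally show ?thesis
      using s u by (intro mclass_cong[OF tf]) (auto simp: nzd_mult)
  qed
  then have "{mclass scale (a' *s n, t' * u) | a' t' n u.
      (a', t') \<in> rclass (a, t) \<and> (n, u) \<in> mclass scale (m, s)} = {mclass scale (a *s m, t * s)}"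
    using mclass_self[OF s(2) tf] rclass_self[OF s(1)] by blast
  then show ?thesis by (simp add: lsmul_def)
qed

text \<open>Freeness over the total quotient ring, freed of denominators: the numerators of a basis
  span the module up to a nonzerodivisor and are independent over the base ring.\<close>

lemma has_rank_basis:
  assumes tf: "torsion_free scale" and rank: "has_rank scale n"
  obtains m where
    "\<And>y. \<exists>d r. nzd d \<and> d *s y = (\<Sum>i<n. r i *s m i)"
    "\<And>r i. (\<Sum>i<n. r i *s m i) = 0 \<Longrightarrow> i < n \<Longrightarrow> r i = 0"
proof -
  obtain b where b: "\<forall>i<n. b i \<in> locM scale"
    and ex1: "\<forall>y\<in>locM scale. \<exists>!q. q \<in> {..<n} \<rightarrow>\<^sub>E Qring \<and> y = lsum scale q b n"
    using rank unfolding has_rank_def by (elim exE conjE)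
  have "\<exists>p. \<forall>i. i < n \<longrightarrow> b i = mclass scale (p i) \<and> nzd (snd (p i))"
  proof (intro choice allI)
    show "\<exists>p. i < n \<longrightarrow> b i = mclass scale p \<and> nzd (snd p)" for i
      using b unfolding locM_def by fastforce
  qed
  then obtain p where p: "\<forall>i. i < n \<longrightarrow> b i = mclass scale (p i) \<and> nzd (snd (p i))" ..
  define m where "m i = fst (p i)" for i
  define s where "s i = snd (p i)" for i
  have ms: "b i = mclass scale (m i, s i)" "nzd (s i)" if "i < n" for i
    using p that by (simp_all add: m_def s_def)
  show thesis
  proof
    fix y
    have "mclass scale (y, 1) \<in> locM scale"
      unfolding locM_def using nzd_one by blast
    from ex1_implies_ex[OF bspec[OF ex1 this]]
    obtain q where "q \<in> {..<n} \<rightarrow>\<^sub>E Qring \<and> mclass scale (y, 1) = lsum scale q b n" ..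
    then have q: "q \<in> {..<n} \<rightarrow>\<^sub>E Qring" "mclass scale (y, 1) = lsum scale q b n"
      by simp_all
    have lsum_eq: "\<exists>d r. nzd d \<and> lsum scale q b k = mclass scale ((\<Sum>i<k. r i *s m i), d)" if "k \<le> n" for k
      using that
    proof (induction k)
      case 0
      then show ?case using nzd_one by auto
    next
      case (Suc k)
      then obtain d r where dr: "nzd d" "lsum scale q b k = mclass scale ((\<Sum>i<k. r i *s m i), d)"
        by auto
      have "q k \<in> Qring" using q(1) Suc.prems by auto
      then obtain a t where at: "q k = rclass (a, t)" "nzd t"
        unfolding Qring_def by blast
      have ts: "nzd (t * s k)" using at ms Suc.prems by (simp add: nzd_mult)
      \<comment> \<open>Over the common denominator \<open>d * (t * s k)\<close> the old
        coefficients are scaled by \<open>t * s k\<close> and the new one by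
        \<open>d\<close>.\<close>
      let ?r = "\<lambda>i. if i < k then (t * s k) * r i else d * a"
      have "lsum scale q b (Suc k) = mclass scale ((t * s k) *s (\<Sum>i<k. r i *s m i) + d *s (a *s m k), d * (t * s k))"
        using Suc.prems at ms dr ts by (simp add: lsmul_mclass[OF tf] lplus_mclass[OF tf])
      also have "(t * s k) *s (\<Sum>i<k. r i *s m i) + d *s (a *s m k) = (\<Sum>i<Suc k. ?r i *s m i)"
        by (simp add: scale_sum_right)
      finally show ?case
        using nzd_mult[OF dr(1) ts] by (intro exI[of _ "d * (t * s k)"] exI[of _ ?r] conjI)
    qed
    from lsum_eq[OF order_refl] obtain d r
      where dr: "nzd d" "lsum scale q b n = mclass scale ((\<Sum>i<n. r i *s m i), d)"
      by (elim exE conjE)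
    then have "((\<Sum>i<n. r i *s m i), d) \<in> mclass scale (y, 1)"
      using mclass_self[OF dr(1) tf] q(2) by simp
    then have "d *s y = (\<Sum>i<n. r i *s m i)" by (simp add: mclass_eq[OF tf])
    with dr(1) show "\<exists>d r. nzd d \<and> d *s y = (\<Sum>i<n. r i *s m i)"
      by (intro exI conjI)
  next
    fix r i assume zero: "(\<Sum>i<n. r i *s m i) = 0" and i: "i < n"
    \<comment> \<open>The factor \<open>s i\<close> cancels the denominator of \<open>b i\<close>.
      The restriction to \<open>{..<n}\<close> makes \<open>?q c\<close> extensional, as the
      uniqueness clause of \<open>has_rank\<close> demands.\<close>
    let ?q = "\<lambda>c. \<lambda>i\<in>{..<n}. rclass (c i * s i, 1 :: 'a)"
    have lsum: "lsum scale (?q c) b k = mclass scale ((\<Sum>i<k. c i *s m i), 1)" if "k \<le> n" for c k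
      using that
    proof (induction k)
      case (Suc k)
      then have k: "k < n" by simp
      have "lsmul scale (?q c k) (b k) = mclass scale ((c k * s k) *s m k, 1 * s k)"
        using k lsmul_mclass[OF tf nzd_one ms(2)[OF k]] by (simp add: ms(1))
      also have "\<dots> = mclass scale (c k *s m k, 1)"
        using ms(2)[OF k] by (intro mclass_cong[OF tf]) (simp_all add: nzd_one mult.commute)
      finally have "lsmul scale (?q c k) (b k) = mclass scale (c k *s m k, 1)" .
      then show ?case
        using Suc by (simp add: lplus_mclass[OF tf nzd_one nzd_one])
    qed simp
    have Q: "?q c \<in> {..<n} \<rightarrow>\<^sub>E Qring" for c
      unfolding Qring_def using nzd_one by auto
    have zero_locM: "mclass scale (0, 1) \<in> locM scale"
      unfolding locM_def using nzd_one by blast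
    have "mclass scale (0, 1) = lsum scale (?q r) b n"
      "mclass scale (0, 1) = lsum scale (?q (\<lambda>_. 0)) b n"
      using lsum[OF order_refl, of r] lsum[OF order_refl, of "\<lambda>_. 0"] zero by simp_all
    then have "?q r = ?q (\<lambda>_. 0)"
      by (intro Ex1_unique[OF bspec[OF ex1 zero_locM]] conjI Q)
    then have "rclass (r i * s i, 1 :: 'a) = rclass (0, 1)"
      using i by (auto dest: fun_cong[of _ _ i])
    then have "(0, 1) \<in> rclass (r i * s i, 1 :: 'a)"
      using rclass_self[OF nzd_one] by blast
    then have "s i * r i = 0" by (simp add: rclass_eq mult.commute)
    then show "r i = 0" using ms(2)[OF i] unfolding nzd_def by blast
  qed
qed

text \<open>Clearing the denominators of finitely many generators turns a coordinate on
  \<open>M \<otimes> Q\<close> into a linear form on \<open>M\<close>.\<close>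

lemma linear_form_of_rank:
  assumes tf: "torsion_free scale" and fg: "fin_gen scale" and rank: "has_rank scale n"
    and nontriv: "\<exists>x :: 'b. x \<noteq> 0"
  obtains \<phi> :: "'b \<Rightarrow> 'a" and b where "nzd (\<phi> b)" "\<And>x y. \<phi> (x + y) = \<phi> x + \<phi> y" "\<And>r x. \<phi> (r *s x) = r * \<phi> x"
proof -
  obtain m where span: "\<And>y. \<exists>d r. nzd d \<and> d *s y = (\<Sum>i<n. r i *s m i)"
    and indep: "\<And>r i. (\<Sum>i<n. r i *s m i) = 0 \<Longrightarrow> i < n \<Longrightarrow> r i = 0"
    using has_rank_basis[OF tf rank] by blast
  obtain S where S: "finite S" "\<And>x. \<exists>c. x = (\<Sum>a\<in>S. c a *s a)"
    using fg unfolding fin_gen_def by blast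
  have "\<exists>p. \<forall>y. nzd (fst (p y)) \<and> fst (p y) *s y = (\<Sum>i<n. snd (p y) i *s m i)"
    using span by (intro choice allI) simp
  then obtain p where p: "\<forall>y. nzd (fst (p y)) \<and> fst (p y) *s y = (\<Sum>i<n. snd (p y) i *s m i)" ..
  define d where "d y = fst (p y)" for y
  define r where "r y = snd (p y)" for y
  have dr: "nzd (d y)" "d y *s y = (\<Sum>i<n. r y i *s m i)" for y
    using p by (auto simp: d_def r_def)
  define D where "D = (\<Prod>a\<in>S. d a)"
  have nzd_D: "nzd D" unfolding D_def using S(1) dr(1) by (simp add: nzd_prod)
  have "\<exists>c. D *s y = (\<Sum>i<n. c i *s m i)" for y
  proof -
    obtain c where c: "y = (\<Sum>a\<in>S. c a *s a)" using S(2) by blast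
    have "D *s a = (\<Sum>i<n. ((\<Prod>a\<in>S-{a}. d a) * r a i) *s m i)" if "a \<in> S" for a
    proof -
      have "D *s a = (\<Prod>a\<in>S-{a}. d a) *s (d a *s a)"
        unfolding D_def using prod.remove[OF S(1) that, of d] by (simp add: mult.commute)
      then show ?thesis by (simp add: dr(2) scale_sum_right)
    qed
    then have "c a *s (D *s a) = (\<Sum>i<n. (c a * ((\<Prod>a\<in>S-{a}. d a) * r a i)) *s m i)" if "a \<in> S" for a
      using that by (simp only: scale_sum_right scale_scale)
    moreover have "D *s y = (\<Sum>a\<in>S. c a *s (D *s a))"
      unfolding c by (simp add: scale_sum_right mult.commute)
    ultimately have "D *s y = (\<Sum>a\<in>S. \<Sum>i<n. (c a * ((\<Prod>a\<in>S-{a}. d a) * r a i)) *s m i)"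
      by simp
    also have "\<dots> = (\<Sum>i<n. (\<Sum>a\<in>S. c a * ((\<Prod>a\<in>S-{a}. d a) * r a i)) *s m i)"
      by (subst sum.swap) (simp add: scale_sum_left)
    finally show ?thesis
      by (rule exI[of _ "\<lambda>i. \<Sum>a\<in>S. c a * ((\<Prod>a\<in>S-{a}. d a) * r a i)"])
  qed
  then have "\<exists>C. \<forall>y. D *s y = (\<Sum>i<n. C y i *s m i)" by (intro choice allI)
  then obtain C where C: "\<And>y. D *s y = (\<Sum>i<n. C y i *s m i)" by blast
  \<comment> \<open>For \<open>n = 0\<close> the nonzerodivisor \<open>D\<close> would annihilate a
    nonzero element.\<close>
  have n: "0 < n"
  proof (rule ccontr)
    assume "\<not> 0 < n"
    then have "D *s y = 0" for y using C by simp
    then show False using tf nzd_D nontriv unfolding torsion_free_def by blast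
  qed
  \<comment> \<open>\<open>C\<close> comes from a choice, so linearity has to be recovered from the
    uniqueness of coordinates.\<close>
  have uniq: "C y 0 = c 0" if "D *s y = (\<Sum>i<n. c i *s m i)" for y c
  proof -
    have "(\<Sum>i<n. (C y i - c i) *s m i) = 0"
      using C[of y] that by (simp add: scale_left_diff_distrib sum_subtractf)
    from indep[OF this n] show ?thesis by simp
  qed
  show thesis
  proof
    \<comment> \<open>The linear form is \<open>\<lambda>y. C y 0\<close>, the coordinate 0 of
      \<open>D *s y\<close>; its value at \<open>m 0\<close> is \<open>D\<close>.\<close>
    have "C (m 0) 0 = (if (0::nat) = 0 then D else 0)"
      by (rule uniq) (use n in \<open>simp add: if_distrib[of "\<lambda>c. c *s _"] cong: if_cong\<close>)
    then show "nzd (C (m 0) 0)" using nzd_D by simp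
    show "C (x + y) 0 = C x 0 + C y 0" for x y
      by (rule uniq) (simp add: scale_right_distrib C scale_left_distrib sum.distrib)
    show "C (r *s x) 0 = r * C x 0" for r x
    proof (rule uniq)
      show "D *s r *s x = (\<Sum>i<n. (r * C x i) *s m i)"
        by (subst scale_left_commute) (simp add: C scale_sum_right)
    qed
  qed
qed

subsection \<open>Local endomorphism rings\<close>

text \<open>Zorn's lemma: the union of a nonempty chain of left ideals omitting \<open>id\<close> is
  again a left ideal omitting \<open>id\<close>.\<close>

lemma left_ideal_in_max_left_ideal:
  assumes I: "left_ideal_E scale I" "id \<notin> I"
  obtains K where "max_left_ideal_E scale K" "I \<subseteq> K"
proof -
  let ?A = "{K. left_ideal_E scale K \<and> I \<subseteq> K \<and> id \<notin> K}"
  have "\<exists>K\<in>?A. \<forall>L\<in>?A. K \<subseteq> L \<longrightarrow> L = K"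
  proof (rule subset_Zorn_nonempty)
    show "?A \<noteq> {}" using I by blast
    fix C assume C: "C \<noteq> {}" "subset.chain ?A C"
    then have A: "\<And>K. K \<in> C \<Longrightarrow> left_ideal_E scale K \<and> I \<subseteq> K \<and> id \<notin> K"
      and chain: "\<And>K L. K \<in> C \<Longrightarrow> L \<in> C \<Longrightarrow> K \<subseteq> L \<or> L \<subseteq> K"
      unfolding subset.chain_def by blast+
    have "(\<lambda>x. f x + g x) \<in> \<Union>C" if fg: "f \<in> \<Union>C" "g \<in> \<Union>C" for f g
    proof -
      obtain K L where "K \<in> C" "f \<in> K" "L \<in> C" "g \<in> L" using fg by blast
      then obtain K where "K \<in> C" "f \<in> K" "g \<in> K" using chain by blast
      with A[of K] show ?thesis unfolding left_ideal_E_def by blast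
    qed
    moreover have "\<Union>C \<subseteq> Endo scale" "(\<lambda>x. 0) \<in> \<Union>C" "\<forall>f\<in>Endo scale. \<forall>g\<in>\<Union>C. f \<circ> g \<in> \<Union>C"
      using A C(1) unfolding left_ideal_E_def by blast+
    ultimately have "left_ideal_E scale (\<Union>C)" unfolding left_ideal_E_def by blast
    then show "\<Union>C \<in> ?A" using A C(1) by blast
  qed
  then obtain K where K: "K \<in> ?A" and max: "\<forall>L\<in>?A. K \<subseteq> L \<longrightarrow> L = K" by (elim bexE)
  have "max_left_ideal_E scale K"
    unfolding max_left_ideal_E_def
  proof (intro conjI allI impI)
    show "L = K" if "left_ideal_E scale L \<and> K \<subseteq> L \<and> id \<notin> L" for L
      using bspec[OF max, of L] K that by auto
  qed (use K in auto)
  moreover have "I \<subseteq> K" using K by simp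
  ultimately show thesis by (rule that)
qed

text \<open>Without a left inverse of \<open>f\<close>, the left ideal of all
  \<open>g \<circ> f\<close> would lie in a maximal one, which is \<open>J\<close>. A left inverse
  of some \<open>f \<notin> J\<close> is again outside \<open>J\<close>, so it has a left inverse
  too, and this must be \<open>f\<close>.\<close>

lemma local_units:
  assumes "End_local scale"
  obtains J where "left_ideal_E scale J" "id \<notin> J"
    "\<And>f. f \<in> Endo scale \<Longrightarrow> f \<notin> J \<Longrightarrow> \<exists>g\<in>Endo scale. g \<circ> f = id \<and> f \<circ> g = id"
proof -
  obtain J where J: "max_left_ideal_E scale J" and uniq: "\<And>K. max_left_ideal_E scale K \<Longrightarrow> K = J"
    using assms unfolding End_local_def by blast
  have lJ: "left_ideal_E scale J" and idJ: "id \<notin> J"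
    using J by (auto simp: max_left_ideal_E_def)
  have Jadd: "\<And>f g. f \<in> J \<Longrightarrow> g \<in> J \<Longrightarrow> (\<lambda>x. f x + g x) \<in> J"
    and Jl: "\<And>f g. f \<in> Endo scale \<Longrightarrow> g \<in> J \<Longrightarrow> f \<circ> g \<in> J"
    using lJ unfolding left_ideal_E_def by blast+
  have left_inv: "\<exists>g\<in>Endo scale. g \<circ> f = id" if f: "f \<in> Endo scale" "f \<notin> J" for f
  proof (rule ccontr)
    assume no: "\<not> ?thesis"
    let ?I = "{g \<circ> f | g. g \<in> Endo scale}"
    have "left_ideal_E scale ?I"
      unfolding left_ideal_E_def
    proof (intro conjI ballI)
      show "?I \<subseteq> Endo scale" using f by (auto intro: comp_Endo)
      show "(\<lambda>x. 0) \<in> ?I" using zero_Endo by (auto intro!: exI[of _ "\<lambda>x. 0"])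
    next
      fix u w assume "u \<in> ?I" "w \<in> ?I"
      then obtain g h where "u = g \<circ> f" "w = h \<circ> f" "g \<in> Endo scale" "h \<in> Endo scale" by blast
      then show "(\<lambda>x. u x + w x) \<in> ?I"
        by (auto intro!: exI[of _ "\<lambda>x. g x + h x"] add_Endo)
    next
      fix u w assume "u \<in> Endo scale" "w \<in> ?I"
      then show "u \<circ> w \<in> ?I" by (auto simp: o_assoc intro: comp_Endo)
    qed
    moreover have "id \<notin> ?I" using no by force
    ultimately obtain K where "max_left_ideal_E scale K" "?I \<subseteq> K"
      by (rule left_ideal_in_max_left_ideal)
    moreover have "f \<in> ?I" using id_Endo by (auto intro!: exI[of _ id])
    ultimately show False using uniq f(2) by blast
  qed
  have "\<exists>g\<in>Endo scale. g \<circ> f = id \<and> f \<circ> g = id" if f: "f \<in> Endo scale" "f \<notin> J" for f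
  proof -
    obtain g where g: "g \<in> Endo scale" "g \<circ> f = id" using left_inv[OF f] by blast
    have "g \<notin> J"
    proof
      assume "g \<in> J"
      then have fg: "f \<circ> g \<in> J" using Jl f(1) by blast
      \<comment> \<open>\<open>?k\<close> is outside \<open>J\<close>, hence left invertible, but it
        vanishes on the image of \<open>f\<close>; this forces \<open>f\<close> to be zero.\<close>
      let ?k = "\<lambda>x. id x - (f \<circ> g) x"
      have "(\<lambda>x. ?k x + (f \<circ> g) x) = id" by auto
      then have "?k \<notin> J" using Jadd[OF _ fg] idJ by metis
      moreover have "?k \<in> Endo scale" using f g by (intro diff_Endo id_Endo comp_Endo)
      ultimately obtain k where k: "k \<in> Endo scale" "k \<circ> ?k = id" using left_inv by blast
      have "f x = 0" for x
      proof -
        have "?k (f x) = 0" using fun_cong[OF g(2), of x] by simp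
        then show ?thesis using fun_cong[OF k(2), of "f x"] Endo_zero[OF k(1)] by simp
      qed
      then have "f = (\<lambda>x. 0)" by blast
      then show False using f(2) lJ by (simp add: left_ideal_E_def)
    qed
    then obtain h where h: "h \<in> Endo scale" "h \<circ> g = id" using left_inv g(1) by blast
    have "h = f" using g(2) h(2) by (metis comp_assoc comp_id id_comp)
    then show ?thesis using g h by blast
  qed
  with lJ idJ show thesis by (rule that)
qed

section \<open>Minimal generating sets over the endomorphism ring\<close>

definition E_span :: "'b set \<Rightarrow> 'b set" where
  "E_span S = {\<Sum>e\<in>S. c e e | c. \<forall>e. c e \<in> Endo scale}"

text \<open>\<open>S\<close> is a generating set of least size. A coefficient outside
  \<open>J\<close> in a relation is left invertible, so the relation could be solved for its
  generator, which could then be dropped.\<close>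

lemma minimal_generators:
  assumes fg: "fin_gen scale"
    and unit: "\<And>f. f \<in> Endo scale \<Longrightarrow> f \<notin> J \<Longrightarrow> \<exists>g\<in>Endo scale. g \<circ> f = id"
  shows "\<exists>S. finite S \<and> E_span S = UNIV \<and>
    (\<forall>c. (\<forall>e. c e \<in> Endo scale) \<longrightarrow> (\<Sum>e\<in>S. c e e) = 0 \<longrightarrow> (\<forall>a\<in>S. c a \<in> J))"
proof -
  let ?P = "\<lambda>S :: 'b set. finite S \<and> E_span S = UNIV"
  obtain S0 where S0: "finite S0" "\<And>x. \<exists>c. x = (\<Sum>a\<in>S0. c a *s a)"
    using fg unfolding fin_gen_def by blast
  have "x \<in> E_span S0" for x
  proof -
    obtain c where "x = (\<Sum>a\<in>S0. c a *s a)" using S0(2) by blast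
    then show ?thesis unfolding E_span_def
      using scale_Endo[OF id_Endo] by (auto intro!: exI[of _ "\<lambda>e z. c e *s z"])
  qed
  then have "?P S0" using S0(1) by blast
  then obtain S where S: "?P S" and least: "\<And>T. ?P T \<Longrightarrow> card S \<le> card T"
    using ex_has_least_nat[of ?P S0 card] by blast
  have "c a \<in> J" if c: "\<And>e. c e \<in> Endo scale" and zero: "(\<Sum>e\<in>S. c e e) = 0" and a: "a \<in> S" for c a
  proof (rule ccontr)
    assume "c a \<notin> J"
    then obtain g where g: "g \<in> Endo scale" "g \<circ> c a = id" using unit c by blast
    have "g (\<Sum>e\<in>S. c e e) = a + (\<Sum>e\<in>S-{a}. g (c e e))"
      using fun_cong[OF g(2), of a] S a by (simp add: sum.remove Endo_add[OF g(1)] Endo_sum[OF g(1)])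
    then have a_eq: "a = (\<Sum>e\<in>S-{a}. - g (c e e))"
      using zero Endo_zero[OF g(1)] by (simp add: sum_negf eq_neg_iff_add_eq_0)
    have "x \<in> E_span (S - {a})" for x
    proof -
      obtain d where d: "\<And>e. d e \<in> Endo scale" "x = (\<Sum>e\<in>S. d e e)"
        using S unfolding E_span_def by blast
      have "x = d a a + (\<Sum>e\<in>S-{a}. d e e)"
        using d(2) S a by (simp add: sum.remove)
      also have "d a a = (\<Sum>e\<in>S-{a}. - d a (g (c e e)))"
        by (subst a_eq) (simp add: Endo_sum[OF d(1)] Endo_neg[OF d(1)])
      finally have "x = (\<Sum>e\<in>S-{a}. d e e - (d a \<circ> (g \<circ> c e)) e)"
        by (simp add: sum_subtractf sum_negf)
      moreover have "(\<lambda>z. d e z - (d a \<circ> (g \<circ> c e)) z) \<in> Endo scale" for e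
        by (intro diff_Endo comp_Endo d(1) g(1) c)
      ultimately show ?thesis unfolding E_span_def
        by (intro CollectI exI[of _ "\<lambda>e z. d e z - (d a \<circ> (g \<circ> c e)) z"]) simp
    qed
    then have "?P (S - {a})" using S by blast
    moreover have "card (S - {a}) < card S" using S a card_Diff1_less[of S a] by blast
    ultimately show False using least[of "S - {a}"] by linarith
  qed
  then have "\<forall>c. (\<forall>e. c e \<in> Endo scale) \<longrightarrow> (\<Sum>e\<in>S. c e e) = 0 \<longrightarrow> (\<forall>a\<in>S. c a \<in> J)" by simp
  with S show ?thesis by (intro exI[of _ S]) simp
qed

lemma cyclic_of_single_generator:
  assumes "E_span S = UNIV" "\<And>a b. a \<in> S \<Longrightarrow> b \<in> S \<Longrightarrow> a = b"
  shows "cyclic_E_module scale"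
proof -
  obtain s where "S \<subseteq> {s}" using assms(2) by blast
  have "\<exists>f\<in>Endo scale. y = f s" for y
  proof -
    obtain c where c: "\<And>e. c e \<in> Endo scale" "y = (\<Sum>e\<in>S. c e e)"
      using assms(1) unfolding E_span_def by blast
    consider "S = {}" | "S = {s}" using \<open>S \<subseteq> {s}\<close> by blast
    then show ?thesis
    proof cases
      case 1
      then show ?thesis using c(2) zero_Endo by (auto intro!: bexI[of _ "\<lambda>x. 0"])
    next
      case 2
      then show ?thesis using c by auto
    qed
  qed
  then show ?thesis unfolding cyclic_E_module_def by blast
qed

subsection \<open>Balanced maps modulo a left ideal\<close>

text \<open>The linear map on the free module with basis vectors \<open>delta p\<close> that sends
  \<open>delta p\<close> to \<open>g p\<close>. Its additivity is available for finite supports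
  only, since infinite sums are 0 by convention.\<close>

definition lin_ext :: "('p \<Rightarrow> 'b) \<Rightarrow> ('p \<Rightarrow> 'a) \<Rightarrow> 'b" where
  "lin_ext g a = (\<Sum>q | a q \<noteq> 0. a q *s g q)"

lemma lin_ext_superset:
  assumes "finite T" "{q. a q \<noteq> 0} \<subseteq> T"
  shows "lin_ext g a = (\<Sum>q\<in>T. a q *s g q)"
  unfolding lin_ext_def using assms by (intro sum.mono_neutral_left) auto

lemma finite_support_add: "finite {q. a q \<noteq> 0} \<Longrightarrow> finite {q. b q \<noteq> 0} \<Longrightarrow> finite {q. a q + b q \<noteq> (0::'a)}"
  by (rule finite_subset[of _ "{q. a q \<noteq> 0} \<union> {q. b q \<noteq> 0}"]) auto

lemma finite_support_smult: "finite {q. a q \<noteq> 0} \<Longrightarrow> finite {q. r * a q \<noteq> (0::'a)}"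
  by (rule finite_subset[of _ "{q. a q \<noteq> 0}"]) auto

lemma finite_support_diff: "finite {q. a q \<noteq> 0} \<Longrightarrow> finite {q. b q \<noteq> 0} \<Longrightarrow> finite {q. a q - b q \<noteq> (0::'a)}"
  by (rule finite_subset[of _ "{q. a q \<noteq> 0} \<union> {q. b q \<noteq> 0}"]) auto

lemma finite_support_delta: "finite {q. delta p q \<noteq> (0::'a)}"
  by (rule finite_subset[of _ "{p}"]) (auto simp: delta_def)

lemma lin_ext_add:
  assumes "finite {q. a q \<noteq> 0}" "finite {q. b q \<noteq> 0}"
  shows "lin_ext g (\<lambda>q. a q + b q) = lin_ext g a + lin_ext g b"
proof -
  let ?T = "{q. a q \<noteq> 0} \<union> {q. b q \<noteq> 0}"
  have T: "finite ?T" using assms by blast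
  show ?thesis
    by (subst (1 2 3) lin_ext_superset[OF T]) (auto simp: scale_left_distrib sum.distrib)
qed

lemma lin_ext_smult:
  assumes "finite {q. a q \<noteq> 0}"
  shows "lin_ext g (\<lambda>q. r * a q) = r *s lin_ext g a"
  by (subst (1 2) lin_ext_superset[OF assms]) (auto simp: scale_sum_right)

lemma lin_ext_diff:
  assumes "finite {q. a q \<noteq> 0}" "finite {q. b q \<noteq> 0}"
  shows "lin_ext g (\<lambda>q. a q - b q) = lin_ext g a - lin_ext g b"
  using lin_ext_add[OF assms(1) finite_support_smult[OF assms(2)], of g "- 1"]
  by (simp add: lin_ext_smult[OF assms(2), of g "- 1", simplified])

lemma lin_ext_delta: "lin_ext g (delta p) = g p"
  by (subst lin_ext_superset[of "{p}"]) (auto simp: delta_def)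

lemmas lin_ext_simps = lin_ext_add lin_ext_smult lin_ext_diff lin_ext_delta
  finite_support_add finite_support_smult finite_support_diff finite_support_delta

lemma left_ideal_scale:
  assumes "left_ideal_E scale J" "f \<in> J"
  shows "(\<lambda>z. r *s f z) \<in> J"
proof -
  have "(\<lambda>z. r *s z) \<circ> f \<in> J"
    using assms scale_Endo[OF id_Endo, of r] unfolding left_ideal_E_def by simp
  then show ?thesis by (simp add: o_def)
qed

lemma left_ideal_add: "left_ideal_E scale J \<Longrightarrow> f \<in> J \<Longrightarrow> g \<in> J \<Longrightarrow> (\<lambda>z. f z + g z) \<in> J"
  by (auto simp: left_ideal_E_def)

lemma left_ideal_diff:
  assumes "left_ideal_E scale J" "f \<in> J" "g \<in> J"
  shows "(\<lambda>z. f z - g z) \<in> J"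
  using left_ideal_add[OF assms(1,2) left_ideal_scale[OF assms(1,3), of "- 1"]] by simp

text \<open>The universal property of the tensor product, with target the endomorphisms modulo
  \<open>J\<close>: a map that is bilinear and balanced modulo \<open>J\<close> sends every relation
  into \<open>J\<close>.\<close>

lemma tens_rel_lin_ext:
  assumes J: "left_ideal_E scale J"
    and addl: "\<And>x x' y. (\<lambda>z. G (x + x') y z - G x y z - G x' y z) \<in> J"
    and addr: "\<And>x y y'. (\<lambda>z. G x (y + y') z - G x y z - G x y' z) \<in> J"
    and scl: "\<And>r x y. (\<lambda>z. G (r *s x) y z - r *s G x y z) \<in> J"
    and scr: "\<And>r x y. (\<lambda>z. G x (r *s y) z - r *s G x y z) \<in> J"
    and bal: "\<And>f x y. f \<in> Endo scale \<Longrightarrow> (\<lambda>z. G (st f x) y z - G x (f y) z) \<in> J"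
    and a: "a \<in> tens_rel scale st"
  shows "(\<lambda>z. lin_ext (\<lambda>(x, y). G x y z) a) \<in> J"
proof -
  \<comment> \<open>Finite support is carried through the induction because
    \<open>lin_ext_add\<close> and \<open>lin_ext_smult\<close> require it.\<close>
  have "finite {q. a q \<noteq> 0} \<and> (\<lambda>z. lin_ext (\<lambda>(x, y). G x y z) a) \<in> J"
    using a
  proof induction
    case zero
    then show ?case using J by (simp add: lin_ext_def left_ideal_E_def)
  next
    case (add a b)
    then show ?case using left_ideal_add[OF J] by (simp add: lin_ext_simps)
  next
    case (smult a r)
    then show ?case using left_ideal_scale[OF J] by (simp add: lin_ext_simps)
  qed (simp_all add: lin_ext_simps assms del: right_minus_eq)
  then show ?thesis ..
qed

subsection \<open>The pairing induced by a linear form\<close>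

definition rank_one :: "('b \<Rightarrow> 'a) \<Rightarrow> 'b \<Rightarrow> 'b \<Rightarrow> 'b" where
  "rank_one \<phi> y = (\<lambda>z. \<phi> z *s y)"

context
  fixes st :: "('b \<Rightarrow> 'b) \<Rightarrow> ('b \<Rightarrow> 'b)"
  assumes star: "star_structure scale st"
begin

lemma st_Endo: "f \<in> Endo scale \<Longrightarrow> st f \<in> Endo scale"
  and st_add: "f \<in> Endo scale \<Longrightarrow> g \<in> Endo scale \<Longrightarrow> st (\<lambda>x. f x + g x) = (\<lambda>x. st f x + st g x)"
  and st_comp: "f \<in> Endo scale \<Longrightarrow> g \<in> Endo scale \<Longrightarrow> st (f \<circ> g) = st g \<circ> st f"
  and st_id: "st id = id"
  and st_scale: "f \<in> Endo scale \<Longrightarrow> st (\<lambda>x. r *s f x) = (\<lambda>x. r *s st f x)"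
  and st_st: "f \<in> Endo scale \<Longrightarrow> st (st f) = f"
  using star unfolding star_structure_def by blast+

context
  fixes \<phi> :: "'b \<Rightarrow> 'a" and b :: 'b
  assumes tf: "torsion_free scale"
    and nzd: "nzd (\<phi> b)"
    and \<phi>_add: "\<And>x y. \<phi> (x + y) = \<phi> x + \<phi> y"
    and \<phi>_scale: "\<And>r x. \<phi> (r *s x) = r * \<phi> x"
begin

text \<open>The right action of \<open>rank_one \<phi> y\<close> on \<open>x\<close>. It represents
  the tensor of \<open>x\<close> and \<open>y\<close>, up to the factor \<open>\<phi> b\<close>, by
  a single module element: the tensor of \<open>pairing x y\<close> and \<open>b\<close>.\<close>

definition pairing :: "'b \<Rightarrow> 'b \<Rightarrow> 'b" where
  "pairing x y = st (rank_one \<phi> y) x"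

lemma rank_one_Endo: "rank_one \<phi> y \<in> Endo scale"
  by (simp add: Endo_iff rank_one_def \<phi>_add \<phi>_scale scale_left_distrib)

lemma rank_one_apply: "f \<in> Endo scale \<Longrightarrow> rank_one \<phi> (f y) = f \<circ> rank_one \<phi> y"
  by (auto simp: rank_one_def Endo_scale)

lemma rank_one_base: "rank_one \<phi> y b = \<phi> b *s y"
  by (simp add: rank_one_def)

lemma pairing_balanced:
  assumes "f \<in> Endo scale"
  shows "pairing x (f y) = pairing (st f x) y"
  using assms by (simp add: pairing_def rank_one_apply st_comp rank_one_Endo)

lemma pairing_left_Endo: "(\<lambda>x. pairing x y) \<in> Endo scale"
  using st_Endo[OF rank_one_Endo[of y]] by (simp add: pairing_def Endo_iff)

lemma pairing_right_Endo: "pairing x \<in> Endo scale"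
proof -
  have "rank_one \<phi> (y + y') = (\<lambda>z. rank_one \<phi> y z + rank_one \<phi> y' z)" for y y'
    by (simp add: rank_one_def scale_right_distrib)
  moreover have "rank_one \<phi> (r *s y) = (\<lambda>z. r *s rank_one \<phi> y z)" for r y
    by (simp add: rank_one_def mult.commute)
  ultimately show ?thesis
    by (simp add: Endo_iff pairing_def st_add[OF rank_one_Endo rank_one_Endo] st_scale[OF rank_one_Endo])
qed

text \<open>\<open>\<phi> b *s y\<close> is \<open>rank_one \<phi> y\<close> applied to
  \<open>b\<close>, and balancedness moves this endomorphism to the left argument. Thus pairing with
  \<open>b\<close> on the right multiplies every value of the pairing by
  \<open>\<phi> b\<close>.\<close>

lemma pairing_base: "\<phi> b *s pairing x y = pairing (pairing x y) b"
proof -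
  have "\<phi> b *s pairing x y = pairing x (rank_one \<phi> y b)"
    by (simp add: rank_one_base Endo_scale[OF pairing_right_Endo])
  then show ?thesis
    by (simp add: pairing_balanced rank_one_Endo) (simp add: pairing_def)
qed

text \<open>As the star is an involution, endomorphisms also move from left to right. Swapping the
  arguments thus amounts, up to \<open>\<phi> b\<close>, to applying
  \<open>pairing b\<close>.\<close>

lemma pairing_flip_base: "\<phi> b *s pairing y x = pairing b (pairing x y)"
proof -
  have "pairing (f y) x = pairing y (st f x)" if "f \<in> Endo scale" for f x y
    using pairing_balanced[OF st_Endo[OF that]] st_st[OF that] by simp
  from this[OF rank_one_Endo, of y b x] show ?thesis
    by (simp add: rank_one_base Endo_scale[OF pairing_left_Endo]) (simp add: pairing_def)
qed

text \<open>After inverting nonzerodivisors the pairing identifies \<open>M\<^sub>* \<otimes>\<^sub>E M\<close> with \<open>p M\<close>,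
  where \<open>p\<close> is the star of a multiple of a rank one idempotent. Since \<open>p E p\<close> consists of
  scalars, the flip \<open>x \<otimes> y \<mapsto> y \<otimes> x\<close> is a scalar.\<close>

lemma pairing_flip_scalar:
  obtains v where "v * v = (\<phi> b * \<phi> b) * (\<phi> b * \<phi> b)"
    "\<And>x y. (\<phi> b * \<phi> b) *s pairing y x = v *s pairing x y"
proof -
  define s where "s = \<phi> b"
  have s: "nzd s" using nzd by (simp add: s_def)
  define \<theta> where "\<theta> = pairing b"
  define p where "p = st (rank_one \<phi> b)"
  define v where "v = \<phi> (st \<theta> b)"
  have \<theta>: "\<theta> \<in> Endo scale" unfolding \<theta>_def by (rule pairing_right_Endo)
  have p: "p \<in> Endo scale" unfolding p_def by (intro st_Endo rank_one_Endo)
  have p_eq: "p x = pairing x b" for x by (simp add: p_def pairing_def)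
  have p\<theta>: "p (\<theta> w) = s *s \<theta> w" for w
    unfolding p_eq \<theta>_def s_def by (simp add: pairing_base)
  \<comment> \<open>With \<open>e = rank_one \<phi> b\<close>, any endomorphism \<open>g\<close>
    satisfies \<open>e \<circ> g \<circ> e = (\<lambda>z. \<phi> (g b) *s e z)\<close>. This is used
    for \<open>g = st \<theta>\<close> and then starred.\<close>
  have "p \<circ> (\<theta> \<circ> p) = st (rank_one \<phi> b \<circ> st \<theta> \<circ> rank_one \<phi> b)"
    by (simp add: st_comp st_st comp_Endo st_Endo rank_one_Endo \<theta> p_def o_assoc)
  also have "rank_one \<phi> b \<circ> st \<theta> \<circ> rank_one \<phi> b = (\<lambda>z. v *s rank_one \<phi> b z)"
    using st_Endo[OF \<theta>] by (auto simp: rank_one_def v_def Endo_scale \<phi>_scale mult.commute)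
  also have "st \<dots> = (\<lambda>z. v *s p z)"
    by (simp add: st_scale rank_one_Endo p_def)
  finally have p\<theta>p: "s *s \<theta> (p w) = v *s p w" for w
    using p\<theta> by (metis comp_apply)
  have flip: "(s * s) *s pairing y x = v *s pairing x y" for x y
  proof -
    let ?w = "pairing x y"
    have w: "p ?w = s *s ?w" by (simp add: p_eq s_def pairing_base)
    \<comment> \<open>The extra factor \<open>s\<close> turns \<open>?w\<close> into
      \<open>p ?w\<close>, where \<open>p\<theta>p\<close> applies; it is cancelled at the
      end.\<close>
    have "s *s ((s * s) *s pairing y x) = s *s (s *s \<theta> ?w)"
      using pairing_flip_base[of y x] by (simp add: s_def \<theta>_def flip: scale_scale)
    also have "\<dots> = s *s \<theta> (p ?w)" by (simp add: w Endo_scale[OF \<theta>])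
    also have "\<dots> = s *s (v *s ?w)" by (simp only: p\<theta>p) (simp add: w mult.commute)
    finally show ?thesis by (rule nzd_scale_cancel[OF tf s])
  qed
  \<comment> \<open>Flipping twice gives the identity on the image of \<open>p\<close>. The star
    carries it to \<open>rank_one \<phi> b\<close>, and evaluating at \<open>b\<close> and applying
    \<open>\<phi>\<close> leaves only the nonzerodivisor \<open>s * s\<close> to cancel.\<close>
  have "(v * v) *s p x = ((s * s) * (s * s)) *s p x" for x
    using flip[of x b] flip[of b x] unfolding p_eq
    by (metis scale_scale scale_left_commute)
  then have "(\<lambda>x. (v * v) *s p x) = (\<lambda>x. ((s * s) * (s * s)) *s p x)" by blast
  then have "st (\<lambda>x. (v * v) *s p x) = st (\<lambda>x. ((s * s) * (s * s)) *s p x)" by (rule arg_cong)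
  moreover have "st p = rank_one \<phi> b" by (simp add: p_def st_st rank_one_Endo)
  ultimately have "(v * v) *s rank_one \<phi> b b = ((s * s) * (s * s)) *s rank_one \<phi> b b"
    using st_scale[OF p] by (metis (no_types))
  then have "\<phi> ((v * v) *s rank_one \<phi> b b) = \<phi> (((s * s) * (s * s)) *s rank_one \<phi> b b)"
    by (rule arg_cong)
  then have "(s * s) * (v * v) = (s * s) * ((s * s) * (s * s))"
    by (simp add: rank_one_base \<phi>_scale s_def[symmetric] ac_simps)
  then have "v * v = (s * s) * (s * s)"
    using nzd_mult_cancel nzd_mult[OF s s] by blast
  with flip show thesis using that by (simp add: s_def)
qed

lemma pairing_flip_sign:
  assumes dom: "is_domain TYPE('a) \<or> is_reduced TYPE('a) \<and> char_two TYPE('a)"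
  obtains \<epsilon> :: 'a where "\<epsilon> = 1 \<or> \<epsilon> = - 1" "\<And>x y. pairing x y = \<epsilon> *s pairing y x"
proof -
  let ?s2 = "\<phi> b * \<phi> b"
  obtain v where v: "v * v = ?s2 * ?s2" and flip: "\<And>x y. ?s2 *s pairing y x = v *s pairing x y"
    using pairing_flip_scalar by blast
  have "v = ?s2 \<or> v = - ?s2"
  proof (cases "is_domain TYPE('a)")
    case True
    have "(v - ?s2) * (v + ?s2) = 0" using v by (simp add: algebra_simps)
    then have "v - ?s2 = 0 \<or> v + ?s2 = 0" using True unfolding is_domain_def by blast
    then show ?thesis by (auto simp: eq_neg_iff_add_eq_0)
  next
    case False
    then have red: "is_reduced TYPE('a)" and "(2::'a) = 0"
      using dom by (auto simp: char_two_def)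
    \<comment> \<open>The cross terms are collected into a multiple of 2, which vanishes in
      characteristic 2.\<close>
    have "(v - ?s2) ^ 2 = v * v - ?s2 * ?s2 + 2 * (?s2 * ?s2 - v * ?s2)"
      by (simp add: power2_eq_square algebra_simps)
    then have "(v - ?s2) ^ 2 = 0" using v \<open>2 = 0\<close> by simp
    then have "v - ?s2 = 0" using red unfolding is_reduced_def by blast
    then show ?thesis by simp
  qed
  then have "v = ?s2 * 1 \<or> v = ?s2 * - 1" by simp
  then obtain \<epsilon> :: 'a where \<epsilon>: "\<epsilon> = 1 \<or> \<epsilon> = - 1" "v = ?s2 * \<epsilon>" by blast
  have "pairing y x = \<epsilon> *s pairing x y" for x y
    by (rule nzd_scale_cancel[OF tf nzd_mult[OF nzd nzd]]) (use flip[of y x] \<epsilon>(2) in simp)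
  with \<epsilon>(1) show thesis by (rule that)
qed

text \<open>The factor \<open>\<phi> b\<close> is absorbed into \<open>y\<close>, giving
  \<open>rank_one \<phi> y b\<close>, and balancing moves \<open>rank_one \<phi> y\<close> over to
  \<open>x\<close>.\<close>

lemma tens_rel_pairing:
  "(\<lambda>q. \<phi> b * delta (x, y) q - delta (pairing x y, b) q) \<in> tens_rel scale st"
proof -
  have "(\<lambda>q. delta (pairing x y, b) q - delta (x, \<phi> b *s y) q) \<in> tens_rel scale st"
    using tens_rel.bal[OF rank_one_Endo[of y], where st = st and x = x and y = b] by (simp add: pairing_def rank_one_base)
  from tens_rel.smult[OF tens_rel.add[OF this tens_rel.scr[where x = x and r = "\<phi> b" and y = y]], of "- 1"]
  show ?thesis by simp
qed

text \<open>The sign rule for the pairing yields \<open>\<phi> b\<close> times the claim;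
  torsion-freeness of the tensor product removes this factor.\<close>

lemma tens_rel_flip:
  assumes ttf: "tensor_torsion_free scale st"
    and sign: "\<And>x y. pairing x y = \<epsilon> *s pairing y x"
  shows "(\<lambda>q. delta (x, y) q - \<epsilon> * delta (y, x) q) \<in> tens_rel scale st"
proof -
  let ?t = "\<lambda>q. delta (x, y) q - \<epsilon> * delta (y, x) q"
  have "(\<lambda>q. \<phi> b * ?t q) = (\<lambda>q. ((\<phi> b * delta (x, y) q - delta (pairing x y, b) q)
      + - \<epsilon> * (\<phi> b * delta (y, x) q - delta (pairing y x, b) q))
      + (delta (\<epsilon> *s pairing y x, b) q - \<epsilon> * delta (pairing y x, b) q))"
    by (simp add: sign[of x y, symmetric] algebra_simps)
  also have "\<dots> \<in> tens_rel scale st"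
    by (rule tens_rel.add[OF tens_rel.add[OF tens_rel_pairing tens_rel.smult[OF tens_rel_pairing]] tens_rel.scl])
  finally have rel: "(\<lambda>q. \<phi> b * ?t q) \<in> tens_rel scale st" .
  have "finite {q. ?t q \<noteq> 0}"
    by (intro finite_support_diff finite_support_smult finite_support_delta)
  with nzd rel have "nzd (\<phi> b) \<and> finite {q. ?t q \<noteq> 0} \<and> (\<lambda>q. \<phi> b * ?t q) \<in> tens_rel scale st"
    by (intro conjI)
  then show ?thesis
    using ttf unfolding tensor_torsion_free_def by (elim allE[of _ "\<phi> b"] allE[of _ ?t] mp)
qed

end

text \<open>The unique maximal left ideal consists of the non-units, which makes it two-sided
  and stable under the involution.\<close>

lemma local_radical:
  assumes "End_local scale"
  obtains J where "left_ideal_E scale J" "id \<notin> J"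
    "\<And>f. f \<in> Endo scale \<Longrightarrow> f \<notin> J \<Longrightarrow> \<exists>g\<in>Endo scale. g \<circ> f = id \<and> f \<circ> g = id"
    "\<And>f g. f \<in> J \<Longrightarrow> g \<in> Endo scale \<Longrightarrow> f \<circ> g \<in> J"
    "\<And>f. f \<in> J \<Longrightarrow> st f \<in> J"
proof -
  obtain J where J: "left_ideal_E scale J" "id \<notin> J"
    and unit: "\<And>f. f \<in> Endo scale \<Longrightarrow> f \<notin> J \<Longrightarrow> \<exists>g\<in>Endo scale. g \<circ> f = id \<and> f \<circ> g = id"
    using local_units[OF assms] by blast
  have JE: "\<And>f. f \<in> J \<Longrightarrow> f \<in> Endo scale" and Jl: "\<And>f g. f \<in> Endo scale \<Longrightarrow> g \<in> J \<Longrightarrow> f \<circ> g \<in> J"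
    using J(1) unfolding left_ideal_E_def by blast+
  have no_left: "g \<circ> f \<noteq> id" if "f \<in> J" "g \<in> Endo scale" for f g
    using Jl[OF that(2,1)] J(2) by auto
  \<comment> \<open>A right inverse \<open>k\<close> of \<open>f\<close> lies outside
    \<open>J\<close>, so it is a two-sided unit with inverse \<open>f\<close>; then \<open>f\<close>
    has a left inverse as well.\<close>
  have no_right: "f \<circ> k \<noteq> id" if f: "f \<in> J" and k: "k \<in> Endo scale" for f k
  proof
    assume eq: "f \<circ> k = id"
    have "k \<notin> J" using no_left[OF _ JE[OF f]] eq by blast
    then obtain h where h: "h \<in> Endo scale" "k \<circ> h = id" using unit k by blast
    have "f = h" using eq h(2) by (metis comp_assoc comp_id id_comp)
    then show False using no_left[OF f k] h(2) by simp
  qed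
  have "f \<circ> g \<in> J" if f: "f \<in> J" and g: "g \<in> Endo scale" for f g
  proof (rule ccontr)
    assume "f \<circ> g \<notin> J"
    then obtain h where h: "h \<in> Endo scale" "(f \<circ> g) \<circ> h = id"
      using unit comp_Endo JE[OF f] g by blast
    then show False using no_right[OF f comp_Endo[OF g h(1)]] by (simp add: comp_assoc)
  qed
  moreover have "st f \<in> J" if f: "f \<in> J" for f
  proof (rule ccontr)
    assume "st f \<notin> J"
    then obtain h where h: "h \<in> Endo scale" "st f \<circ> h = id"
      using unit st_Endo JE[OF f] by blast
    \<comment> \<open>The star reverses products, so a right inverse of \<open>st f\<close> becomes
      a left inverse of \<open>f\<close>.\<close>
    then have "st h \<circ> f = id"
      using st_comp[OF st_Endo[OF JE[OF f]] h(1)] st_st[OF JE[OF f]] st_id by simp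
    then show False using no_left[OF f st_Endo[OF h(1)]] by blast
  qed
  ultimately show thesis using that[OF J unit] by blast
qed

subsection \<open>Two independent generators\<close>

text \<open>For \<open>a \<noteq> b\<close> in a minimal generating set over \<open>E\<close>, the coordinates modulo \<open>J\<close> give a
  balanced map \<open>(x, y) \<mapsto> x\<^sub>a\<^sup>* y\<^sub>b\<close> into \<open>E/J\<close> which separates \<open>a \<otimes> b\<close> from all multiples of \<open>b \<otimes> a\<close>.\<close>

lemma cyclic_of_flip:
  assumes fg: "fin_gen scale" and local: "End_local scale"
    and flip: "\<And>x y. (\<lambda>q. delta (x, y) q - \<epsilon> * delta (y, x) q) \<in> tens_rel scale st"
  shows "cyclic_E_module scale"
proof -
  obtain J where J: "left_ideal_E scale J" "id \<notin> J"
    and unit: "\<And>f. f \<in> Endo scale \<Longrightarrow> f \<notin> J \<Longrightarrow> \<exists>g\<in>Endo scale. g \<circ> f = id \<and> f \<circ> g = id"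
    and Jr: "\<And>f g. f \<in> J \<Longrightarrow> g \<in> Endo scale \<Longrightarrow> f \<circ> g \<in> J"
    and Jst: "\<And>f. f \<in> J \<Longrightarrow> st f \<in> J"
    using local_radical[OF local] by blast
  have Jl: "\<And>f g. f \<in> Endo scale \<Longrightarrow> g \<in> J \<Longrightarrow> f \<circ> g \<in> J"
    using J(1) unfolding left_ideal_E_def by blast+
  have left_unit: "\<exists>g\<in>Endo scale. g \<circ> f = id" if "f \<in> Endo scale" "f \<notin> J" for f
    using unit[OF that] by blast
  from minimal_generators[OF fg left_unit]
  obtain S where gens: "finite S \<and> E_span S = UNIV \<and>
    (\<forall>c. (\<forall>e. c e \<in> Endo scale) \<longrightarrow> (\<Sum>e\<in>S. c e e) = 0 \<longrightarrow> (\<forall>a\<in>S. c a \<in> J))" ..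
  have S: "finite S" "E_span S = UNIV"
    using gens[THEN conjunct1] gens[THEN conjunct2, THEN conjunct1] .
  have indep: "c a \<in> J" if "\<And>e. c e \<in> Endo scale" "(\<Sum>e\<in>S. c e e) = 0" "a \<in> S" for c a
  proof -
    from gens have "\<forall>c. (\<forall>e. c e \<in> Endo scale) \<longrightarrow> (\<Sum>e\<in>S. c e e) = 0 \<longrightarrow> (\<forall>a\<in>S. c a \<in> J)"
      by (elim conjE)
    from spec[OF this, of c] that show ?thesis by blast
  qed
  have "\<exists>c. (\<forall>e. c e \<in> Endo scale) \<and> (\<Sum>e\<in>S. c e e) = x" for x
  proof -
    have "x \<in> E_span S" using S(2) by simp
    then obtain c where "x = (\<Sum>e\<in>S. c e e) \<and> (\<forall>e. c e \<in> Endo scale)"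
      unfolding E_span_def mem_Collect_eq ..
    then show ?thesis by (intro exI[of _ c]) simp
  qed
  then have "\<exists>F. \<forall>x. (\<forall>e. F x e \<in> Endo scale) \<and> (\<Sum>e\<in>S. F x e e) = x"
    by (intro choice allI)
  then obtain F where F: "\<And>x e. F x e \<in> Endo scale" "\<And>x. (\<Sum>e\<in>S. F x e e) = x"
    by blast
  \<comment> \<open>The chosen coordinates \<open>F\<close> are neither unique nor additive, but by
    \<open>indep\<close> any two coordinate families of the same element agree modulo
    \<open>J\<close>.\<close>
  have coord: "(\<lambda>z. F x e z - c e z) \<in> J"
    if c: "\<And>e. c e \<in> Endo scale" and x: "x = (\<Sum>e\<in>S. c e e)" and e: "e \<in> S" for x c e
  proof (rule indep[of "\<lambda>e z. F x e z - c e z"])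
    show "(\<Sum>e\<in>S. F x e e - c e e) = 0"
      using F(2)[of x] x by (simp add: sum_subtractf)
  qed (use e F(1) c in \<open>auto intro: diff_Endo\<close>)
  have F_add: "(\<lambda>z. F (x + y) e z - (F x e z + F y e z)) \<in> J" if "e \<in> S" for x y e
    using that F by (intro coord) (auto simp: sum.distrib intro: add_Endo)
  have F_scale: "(\<lambda>z. F (r *s x) e z - r *s F x e z) \<in> J" if "e \<in> S" for r x e
    using that F(1) by (intro coord) (auto simp: F(2) scale_sum_right[symmetric] intro: scale_Endo)
  have F_apply: "(\<lambda>z. F (f x) e z - (f \<circ> F x e) z) \<in> J" if "f \<in> Endo scale" "e \<in> S" for f x e
  proof (rule coord[of "\<lambda>e. f \<circ> F x e"])
    show "f x = (\<Sum>e\<in>S. (f \<circ> F x e) e)"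
      using Endo_sum[OF that(1), of "\<lambda>e. F x e e" S] by (simp add: F(2))
  qed (use that F(1) in \<open>auto intro: comp_Endo simp del: comp_apply\<close>)
  have F_gen: "(\<lambda>z. F a e z - (if a = e then z else 0)) \<in> J" if "a \<in> S" "e \<in> S" for a e
  proof (rule coord[of "\<lambda>e z. if a = e then z else 0"])
    show "(\<lambda>z. if a = e then z else 0) \<in> Endo scale" for e
      by (auto simp: Endo_iff)
    show "a = (\<Sum>e\<in>S. if a = e then e else 0)" using that S(1) by (simp add: sum.delta)
  qed (rule that)
  have st_diff: "st (\<lambda>z. f z - g z) = (\<lambda>z. st f z - st g z)" if "f \<in> Endo scale" "g \<in> Endo scale" for f g
    using st_add[OF that(1) scale_Endo[OF that(2), of "- 1"]] st_scale[OF that(2), of "- 1"] by simp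
  show ?thesis
  proof (rule cyclic_of_single_generator[OF S(2)], rule ccontr)
    fix a b assume a: "a \<in> S" and b: "b \<in> S" and ne: "a \<noteq> b"
    define G where "G x y = st (F x a) \<circ> F y b" for x y
    \<comment> \<open>Changing the starred factor modulo \<open>J\<close> is harmless because
      \<open>J\<close> is stable under the star and under right multiplication; \<open>right\<close>
      uses that \<open>J\<close> is a left ideal.\<close>
    have left: "(\<lambda>z. st f (F y b z) - st g (F y b z)) \<in> J"
      if "(\<lambda>z. f z - g z) \<in> J" "f \<in> Endo scale" "g \<in> Endo scale" for f g y
      using Jr[OF Jst[OF that(1)] F(1)[of y b]] by (simp add: st_diff that o_def)
    have right: "(\<lambda>z. st (F x a) (f z) - st (F x a) (g z)) \<in> J"
      if "(\<lambda>z. f z - g z) \<in> J" for f g x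
      using Jl[OF st_Endo[OF F(1)[of x a]] that]
      by (simp add: o_def Endo_diff[OF st_Endo[OF F(1)]])
    note endo = F(1) add_Endo scale_Endo
    have "(\<lambda>z. lin_ext (\<lambda>(x, y). G x y z) (\<lambda>q. delta (a, b) q - \<epsilon> * delta (b, a) q)) \<in> J"
    proof (rule tens_rel_lin_ext[OF J(1)])
      show "(\<lambda>z. G (x + x') y z - G x y z - G x' y z) \<in> J" for x x' y
        using left[OF F_add[OF a, of x x']] by (simp add: endo st_add G_def algebra_simps)
      show "(\<lambda>z. G x (y + y') z - G x y z - G x y' z) \<in> J" for x y y'
        using right[OF F_add[OF b, of y y']]
        by (simp add: Endo_add[OF st_Endo[OF F(1)]] G_def algebra_simps)
      show "(\<lambda>z. G (r *s x) y z - r *s G x y z) \<in> J" for r x y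
        using left[OF F_scale[OF a, of r x]] by (simp add: endo st_scale G_def)
      show "(\<lambda>z. G x (r *s y) z - r *s G x y z) \<in> J" for r x y
        using right[OF F_scale[OF b, of r y]] by (simp add: Endo_scale[OF st_Endo[OF F(1)]] G_def)
      show "(\<lambda>z. G (st f x) y z - G x (f y) z) \<in> J" if f: "f \<in> Endo scale" for f x y
      proof -
        \<comment> \<open>Both sides of the balancing relation are compared with
          \<open>st (F x a) \<circ> f \<circ> F y b\<close>.\<close>
        have "(\<lambda>z. G (st f x) y z - st (F x a) (f (F y b z))) \<in> J"
          using left[OF F_apply[OF st_Endo[OF f] a, of x] F(1) comp_Endo[OF st_Endo[OF f] F(1)], of y]
          by (simp add: st_comp[OF st_Endo[OF f] F(1)] st_st[OF f] G_def)
        from left_ideal_diff[OF J(1) this right[OF F_apply[OF f b, of y], of x]]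
        show ?thesis by (simp add: G_def)
      qed
    qed (rule flip)
    then have sep: "(\<lambda>z. G a b z - \<epsilon> *s G b a z) \<in> J"
      by (simp add: lin_ext_simps)
    \<comment> \<open>The coordinate of \<open>b\<close> at \<open>a\<close> vanishes modulo
      \<open>J\<close>, so the term with \<open>\<epsilon>\<close> disappears whatever
      \<open>\<epsilon>\<close> is.\<close>
    have "F b a \<in> J" using F_gen[OF b a] ne by auto
    then have "G b a \<in> J" unfolding G_def by (intro Jr Jst F(1))
    from left_ideal_add[OF J(1) sep left_ideal_scale[OF J(1) this, of \<epsilon>]]
    have Gab: "G a b \<in> J" by simp
    have Fa: "(\<lambda>z. F a a z - id z) \<in> J" and Fb: "(\<lambda>z. F b b z - id z) \<in> J"
      using F_gen[OF a a] F_gen[OF b b] by simp_all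
    \<comment> \<open>Since \<open>F a a\<close> and \<open>F b b\<close> are both \<open>id\<close>
      modulo \<open>J\<close>, so is \<open>G a b\<close>; membership of \<open>G a b\<close> in
      \<open>J\<close> then puts \<open>id\<close> into \<open>J\<close>.\<close>
    have "(\<lambda>z. G a b z - F b b z) \<in> J"
      using left[OF Fa F(1) id_Endo, of b] by (simp add: G_def st_id)
    from left_ideal_diff[OF J(1) Gab this] have "F b b \<in> J" by simp
    from left_ideal_diff[OF J(1) this Fb] have "id \<in> J" by (simp add: id_def)
    with J(2) show False by contradiction
  qed
qed

end

end

theorem theorem3p6:
  fixes sc :: "'r::comm_ring_1 \<Rightarrow> 'm::ab_group_add \<Rightarrow> 'm"
    and st :: "('m \<Rightarrow> 'm) \<Rightarrow> ('m \<Rightarrow> 'm)"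
  assumes "noetherian_ring TYPE('r)"
    and "local_ring TYPE('r)"
    and "module sc"
    and "fin_gen sc"
    and "torsion_free sc"
    and "\<exists>n. has_rank sc n"
    and "End_local sc"
    and "star_structure sc st"
    and "is_domain TYPE('r) \<or> (is_reduced TYPE('r) \<and> char_two TYPE('r))"
    and "tensor_torsion_free sc st"
  shows "cyclic_E_module sc"
\<comment> \<open>The zero module is treated apart: a coordinate form exists only in positive
  rank.\<close>
proof (cases "\<exists>x :: 'm. x \<noteq> 0")
  case True
  interpret module sc by (rule assms(3))
  obtain n where "has_rank sc n" using assms(6) by blast
  then obtain \<phi> :: "'m \<Rightarrow> 'r" and b where \<phi>: "nzd (\<phi> b)" "\<And>x y. \<phi> (x + y) = \<phi> x + \<phi> y"
      "\<And>r x. \<phi> (sc r x) = r * \<phi> x"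
    using linear_form_of_rank[OF assms(5,4) _ True] by blast
  note star = assms(8)
  obtain \<epsilon> :: 'r where "\<And>x y. pairing st \<phi> x y = sc \<epsilon> (pairing st \<phi> y x)"
    using pairing_flip_sign[OF star assms(5) \<phi> assms(9)] by blast
  then have "(\<lambda>q. delta (x, y) q - \<epsilon> * delta (y, x) q) \<in> tens_rel sc st" for x y
    by (rule tens_rel_flip[OF star assms(5) \<phi> assms(10)])
  then show ?thesis
    by (rule cyclic_of_flip[OF star assms(4,7)])
next
  case False
  interpret module sc by (rule assms(3))
  show ?thesis
    using False zero_Endo unfolding cyclic_E_module_def by metis
qed

end
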